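(* Assume Zaremba's conjecture: there is a constant $m$ such that for every integer $q\ge 1$ there is an integer $p$ coprime to $q$ such that $$\frac{p}{q}=[a_0,a_1,a_2,\dots]$$ (a finite continued fraction) with all the integers $a_i$ between $1$ and $m$. Then there exists an integer $m'$ such that every real quadratic field $\mathbb{Q}[\sqrt{\delta}]$ contains infinitely many periodic continued fractions uniformly bounded by $m'$.
   Context: $[a_0,a_1,a_2,\dots]=a_0+1/(a_1+1/(a_2+\cdots))$. A periodic continued fraction is a real number $[\overline{a_1,\dots,a_p}]$ whose continued fraction expansion is purely periodic with period $(a_1,\dots,a_p)$, $a_i\ge 1$ integers; it is bounded by $m'$ if all its partial quotients $a_i$ satisfy $1\le a_i\le m'$. *)

theory Defs
  imports Complex_Main
begin

text \<open>Value of the finite continued fraction \<open>[a\<^sub>0, \<dots>, a\<^sub>n]\<close>; unspecified on the empty list.\<close>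

fun cfrac_fin :: "int list \<Rightarrow> real" where
  "cfrac_fin [a] = of_int a"
| "cfrac_fin (a # b # as) = of_int a + 1 / cfrac_fin (b # as)"

text \<open>An infinite continued fraction is the limit of its finite truncations. When all
  \<open>a i \<ge> 1\<close> the limit exists and \<open>a\<close> is the only such expansion of \<open>x\<close>.\<close>

definition has_cfrac :: "real \<Rightarrow> (nat \<Rightarrow> int) \<Rightarrow> bool" where
  "has_cfrac x a \<longleftrightarrow> (\<lambda>n. cfrac_fin (map a [0..<Suc n])) \<longlonglongrightarrow> x"

definition periodic_cfrac_bounded :: "int \<Rightarrow> real \<Rightarrow> bool" where
  "periodic_cfrac_bounded m x \<longleftrightarrow>
     (\<exists>as. as \<noteq> [] \<and> (\<forall>a\<in>set as. 1 \<le> a \<and> a \<le> m) \<and>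
           has_cfrac x (\<lambda>n. as ! (n mod length as)))"

definition zaremba_conjecture :: bool where
  "zaremba_conjecture \<longleftrightarrow>
     (\<exists>m::int. \<forall>q::int. q \<ge> 1 \<longrightarrow>
        (\<exists>p as. coprime p q \<and> as \<noteq> [] \<and> (\<forall>a\<in>set as. 1 \<le> a \<and> a \<le> m) \<and>
                of_int p / of_int q = cfrac_fin as))"

text \<open>Intended for \<open>\<delta> > 0\<close>, where it is the subring \<open>\<rat>[\<surd>\<delta>]\<close> of the reals: a real quadratic
  field when \<open>\<surd>\<delta>\<close> is irrational. Every real quadratic field arises this way.\<close>

definition quadratic_field :: "int \<Rightarrow> real set" where
  "quadratic_field \<delta> = {of_rat a + of_rat b * sqrt (of_int \<delta>) | a b. True}"

end

theory Submission
  imports Defs "HOL-Analysis.Kronecker_Approximation_Theorem"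
begin

text \<open>For \<open>q\<^sup>2 - \<delta> y\<^sup>2 = 1\<close>, the square of the unit \<open>q + y \<surd>\<delta>\<close> has trace \<open>4 q\<^sup>2 - 2\<close>. Zaremba's
  conjecture gives a word with bounded partial quotients and continuant \<open>q\<close>. Following it by
  two ones and its reverse, again by two ones, and lowering two of the end quotients by one,
  produces a period whose matrix has determinant \<open>1\<close>, trace \<open>4 q\<^sup>2 - 2\<close> and lower left entry
  \<open>2 q\<^sup>2\<close>. Its fixed point is \<open>r + (y / q) \<surd>\<delta>\<close> with \<open>r\<close> rational, and \<open>y / q\<close> determines \<open>q\<close>,
  so the infinitely many solutions of Pell's equation give infinitely many numbers.\<close>

section \<open>Pell's equation\<close>

text \<open>Dirichlet approximation gives infinitely many reduced fractions \<open>h / k\<close>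
  near \<open>s\<close> whose norms \<open>h\<^sup>2 - \<delta> * k\<^sup>2\<close> stay bounded. By
  pigeonhole two of them share the norm \<open>n\<close> and both residues modulo \<open>n\<close>;
  the quotient of the two numbers \<open>h + k * s\<close> then has integral coordinates and norm
  one.\<close>

lemma pell_nontrivial_solution:
  fixes \<delta> :: int
  assumes "\<delta> > 0" and irr: "sqrt (of_int \<delta>) \<notin> \<rat>"
  shows "\<exists>q y. q > 0 \<and> y > 0 \<and> q\<^sup>2 - \<delta> * y\<^sup>2 = (1::int)"
proof -
  define s where "s = sqrt (real_of_int \<delta>)"
  have s2: "s * s = of_int \<delta>" and s0: "s > 0"
    using assms(1) by (auto simp: s_def)
  define S where "S = approx_set s"
  have inf: "infinite S"
    using irr rational_iff_finite_approx_set unfolding S_def s_def by blast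
  define N where "N = (\<lambda>h k::int. h\<^sup>2 - \<delta> * k\<^sup>2)"
  define C where "C = \<lceil>2 * s + 1\<rceil>"
  have S: "k > 0" "coprime h k" "\<bar>N h k\<bar> \<le> C" if "(h, k) \<in> S" for h k
  proof -
    from that have k: "k > 0" and co: "coprime h k"
      and ap: "\<bar>s - of_int h / of_int k\<bar> < 1 / (of_int k)\<^sup>2"
      by (auto simp: S_def approx_set_def)
    show "k > 0" "coprime h k" by fact+
    define e where "e = s * k - h"
    have "e = k * (s - of_int h / of_int k)"
      using k by (simp add: e_def field_simps)
    then have "\<bar>e\<bar> = k * \<bar>s - of_int h / of_int k\<bar>"
      using k by (simp add: abs_mult)
    also have "\<dots> < k * (1 / (of_int k)\<^sup>2)"
      using ap k by (intro mult_strict_left_mono) auto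
    also have "\<dots> = 1 / k"
      using k by (simp add: power2_eq_square)
    finally have e: "\<bar>e\<bar> < 1 / k" .
    have "1 / real_of_int k \<le> 1"
      using k by simp
    with e have e1: "\<bar>e\<bar> \<le> 1" by linarith
    \<comment> \<open>Substituting \<open>h = s * k - e\<close> leaves a cross term, which
      \<open>\<bar>e\<bar> * k < 1\<close> controls; this is where \<open>C\<close> comes
      from.\<close>
    have "real_of_int (N h k) = e * e - e * k * (2 * s)"
      unfolding N_def e_def by (simp add: power2_eq_square algebra_simps flip: s2)
    also have "\<bar>\<dots>\<bar> \<le> \<bar>e\<bar> * \<bar>e\<bar> + (\<bar>e\<bar> * k) * (2 * s)"
      using abs_triangle_ineq4[of "e * e" "e * k * (2 * s)"] k s0 by (simp add: abs_mult)
    also have "\<dots> \<le> 1 * 1 + 1 * (2 * s)"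
      using e e1 k s0 by (intro add_mono mult_mono) (auto simp: field_simps)
    finally show "\<bar>N h k\<bar> \<le> C"
      unfolding C_def by linarith
  qed
  define f where "f = (\<lambda>(h, k). (N h k, h mod N h k, k mod N h k))"
  have "f ` S \<subseteq> {-C..C} \<times> {-C..C} \<times> {-C..C}"
  proof (clarsimp simp: f_def)
    fix h k assume hk: "(h, k) \<in> S"
    have N0: "N h k \<noteq> 0"
    proof
      assume "N h k = 0"
      then have "real_of_int (h\<^sup>2) = of_int (\<delta> * k\<^sup>2)"
        by (simp add: N_def)
      then have "(of_int h / of_int k)\<^sup>2 = real_of_int \<delta>"
        using S(1)[OF hk] by (simp add: field_simps)
      then have "s = \<bar>of_int h / of_int k\<bar>"
        unfolding s_def by (metis real_sqrt_abs)
      then show False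
        using irr unfolding s_def by (metis Rats_abs_iff Rats_divide Rats_of_int)
    qed
    have "\<bar>m mod N h k\<bar> \<le> C" for m
      using abs_mod_less[OF N0, of m] S(3)[OF hk] by linarith
    from this[of h] this[of k] S(3)[OF hk]
    show "- C \<le> N h k \<and> N h k \<le> C \<and> - C \<le> h mod N h k \<and> h mod N h k \<le> C \<and>
          - C \<le> k mod N h k \<and> k mod N h k \<le> C"
      by linarith
  qed
  then have "finite (f ` S)"
    by (rule finite_subset) auto
  from pigeonhole_infinite[OF inf this] obtain x0
    where x0: "x0 \<in> S" "infinite {x \<in> S. f x = f x0}" by blast
  then have "infinite ({x \<in> S. f x = f x0} - {x0})"
    by simp
  then obtain x1 where x1: "x1 \<in> S" "f x1 = f x0" "x1 \<noteq> x0"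
    using infinite_imp_nonempty by blast
  obtain h k where hk: "x0 = (h, k)" by force
  obtain h' k' where hk': "x1 = (h', k')" by force
  define n where "n = N h k"
  have n': "N h' k' = n" and cong: "h' mod n = h mod n" "k' mod n = k mod n"
    using x1(2) by (auto simp: f_def hk hk' n_def)
  have pos: "k > 0" "k' > 0" and co: "coprime h k" "coprime h' k'"
    using S x0(1) x1(1) hk hk' by auto
  have neq: "h * k' \<noteq> h' * k"
  proof
    assume eq: "h * k' = h' * k"
    then have "k dvd k'" "k' dvd k"
      using co by (metis coprime_commute coprime_dvd_mult_right_iff dvd_triv_right)+
    then have "k = k'" using pos by (simp add: zdvd_antisym_nonneg)
    with eq pos have "h = h'" by simp
    with \<open>k = k'\<close> x1(3) show False by (simp add: hk hk')
  qed
  \<comment> \<open>Reduction modulo \<open>0\<close> is the identity, so a zero norm would make the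
    two pairs equal.\<close>
  have n0: "n \<noteq> 0"
  proof
    assume "n = 0"
    then have "h' = h" "k' = k" using cong by auto
    then show False using neq by simp
  qed
  \<comment> \<open>\<open>X\<close> and \<open>Y\<close> are the coordinates of
    \<open>(h' + k' * s) / (h + k * s)\<close>. Rationalising divides by \<open>n\<close>, and the
    congruences make both numerators divisible by it.\<close>
  have "(h' * h - \<delta> * (k' * k)) mod n = (h * h - \<delta> * (k * k)) mod n"
    using cong by (intro mod_diff_cong mod_mult_cong) auto
  also have "\<dots> = 0" by (simp add: n_def N_def power2_eq_square)
  finally obtain X where X: "h' * h - \<delta> * (k' * k) = n * X" by auto
  have "(h * k' - h' * k) mod n = (h * k - h * k) mod n"
    using cong by (intro mod_diff_cong mod_mult_cong) auto
  then have "n dvd h * k' - h' * k" by auto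
  then obtain Y where Y: "h * k' - h' * k = n * Y" by auto
  have "n\<^sup>2 * (X\<^sup>2 - \<delta> * Y\<^sup>2) = (n * X)\<^sup>2 - \<delta> * (n * Y)\<^sup>2"
    by algebra
  also have "\<dots> = N h k * N h' k'"
    unfolding X[symmetric] Y[symmetric] N_def by algebra
  also have "\<dots> = n\<^sup>2 * 1"
    using n' by (simp add: n_def power2_eq_square)
  finally have pell: "X\<^sup>2 - \<delta> * Y\<^sup>2 = 1"
    using n0 by simp
  have "Y \<noteq> 0" using Y neq by auto
  moreover have "X \<noteq> 0"
  proof
    assume "X = 0"
    moreover have "\<delta> * Y\<^sup>2 \<ge> 0" using assms(1) by simp
    ultimately show False using pell by simp
  qed
  ultimately show ?thesis
    using pell by (intro exI[of _ "\<bar>X\<bar>"] exI[of _ "\<bar>Y\<bar>"]) auto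
qed

text \<open>Squaring the unit \<open>q + y * sqrt \<delta>\<close> gives another solution with a
  strictly larger first coordinate.\<close>

lemma pell_unbounded:
  fixes \<delta> :: int
  assumes "\<delta> > 0" and "sqrt (of_int \<delta>) \<notin> \<rat>"
  shows "\<exists>q y. q > int n \<and> y > 0 \<and> q\<^sup>2 - \<delta> * y\<^sup>2 = 1"
proof (induction n)
  case 0
  then show ?case using pell_nontrivial_solution[OF assms] by auto
next
  case (Suc n)
  then obtain q y where qy: "q > int n" "y > 0" "q\<^sup>2 - \<delta> * y\<^sup>2 = 1" by blast
  have "q > 0" using qy(1) by simp
  have "\<delta> * y\<^sup>2 \<ge> 1"
    using assms(1) qy(2) by (simp add: int_one_le_iff_zero_less)
  moreover have "q\<^sup>2 \<ge> q"
    using \<open>q > 0\<close> by (simp add: power2_eq_square)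
  ultimately have "q\<^sup>2 + \<delta> * y\<^sup>2 > int (Suc n)"
    using qy(1) by linarith
  moreover have "(q\<^sup>2 + \<delta> * y\<^sup>2)\<^sup>2 - \<delta> * (2 * q * y)\<^sup>2 = (q\<^sup>2 - \<delta> * y\<^sup>2)\<^sup>2"
    by algebra
  ultimately show ?case
    using qy \<open>q > 0\<close> by (intro exI[of _ "q\<^sup>2 + \<delta> * y\<^sup>2"] exI[of _ "2 * q * y"]) simp
qed

section \<open>Continuant matrices\<close>

text \<open>The tuple \<open>(a, b, c, d)\<close> stands for the matrix with rows \<open>(a, b)\<close> and \<open>(c, d)\<close>.\<close>

type_synonym mat2 = "int \<times> int \<times> int \<times> int"

fun mmul :: "mat2 \<Rightarrow> mat2 \<Rightarrow> mat2" where
  "mmul (a, b, c, d) (a', b', c', d') =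
     (a * a' + b * c', a * b' + b * d', c * a' + d * c', c * b' + d * d')"

fun mtrans :: "mat2 \<Rightarrow> mat2" where
  "mtrans (a, b, c, d) = (a, c, b, d)"

fun mdet :: "mat2 \<Rightarrow> int" where
  "mdet (a, b, c, d) = a * d - b * c"

text \<open>The columns are numerator and denominator of the last two convergents, with
  \<open>1 / 0\<close> standing before the first one.\<close>

primrec cmat :: "int list \<Rightarrow> mat2" where
  "cmat [] = (1, 0, 0, 1)"
| "cmat (a # as) = mmul (a, 1, 1, 0) (cmat as)"

definition continuant :: "int list \<Rightarrow> int" where
  "continuant as = fst (cmat as)"

lemma mmul_assoc: "mmul (mmul A B) C = mmul A (mmul B C)"
  by (cases A; cases B; cases C) (simp add: algebra_simps)

lemma mmul_one [simp]: "mmul (1, 0, 0, 1) A = A" "mmul A (1, 0, 0, 1) = A"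
  by (cases A; simp)+

lemma mtrans_mmul: "mtrans (mmul A B) = mmul (mtrans B) (mtrans A)"
  by (cases A; cases B) (simp add: algebra_simps)

lemma mdet_mmul: "mdet (mmul A B) = mdet A * mdet B"
  by (cases A; cases B) (simp add: algebra_simps)

lemma cmat_append: "cmat (as @ bs) = mmul (cmat as) (cmat bs)"
  by (induction as) (simp_all add: mmul_assoc)

text \<open>Every factor \<open>(a, 1, 1, 0)\<close> is symmetric, so transposing the product only
  reverses the order of the factors.\<close>

lemma cmat_rev: "cmat (rev as) = mtrans (cmat as)"
  by (induction as) (simp_all add: cmat_append mtrans_mmul)

lemma mdet_cmat: "mdet (cmat as) = (-1) ^ length as"
  by (induction as) (simp_all add: mdet_mmul)

lemma continuant_rev: "continuant (rev as) = continuant as"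
  by (cases "cmat as") (simp add: continuant_def cmat_rev)

text \<open>Used to remove a one from the end of a word: the value of the fraction changes, but the
  continuant survives.\<close>

lemma continuant_merge_one: "continuant (1 # b # as) = continuant ((b + 1) # as)"
  by (cases "cmat as") (simp add: continuant_def algebra_simps)

lemma cmat_positive:
  assumes "\<forall>a\<in>set as. a \<ge> 1" "cmat as = (p, r, s, t)"
  shows "p \<ge> 1 \<and> r \<ge> 0 \<and> s \<ge> 0 \<and> t \<ge> 0 \<and> (as \<noteq> [] \<longrightarrow> r \<ge> 1 \<and> s \<ge> 1)"
  using assms
proof (induction as arbitrary: p r s t)
  case (Cons a as)
  obtain p' r' s' t' where C: "cmat as = (p', r', s', t')"
    by (cases "cmat as")
  have IH: "p' \<ge> 1 \<and> r' \<ge> 0 \<and> s' \<ge> 0 \<and> t' \<ge> 0 \<and> (as \<noteq> [] \<longrightarrow> r' \<ge> 1 \<and> s' \<ge> 1)"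
    using Cons C by auto
  have a: "a \<ge> 1" using Cons.prems by simp
  have eqs: "p = a * p' + s'" "r = a * r' + t'" "s = p'" "t = r'"
    using Cons.prems C by auto
  have "a * p' \<ge> 1" "a * r' \<ge> 0"
    using a IH mult_mono[of 1 a 1 p'] by auto
  moreover have "a * r' + t' \<ge> 1"
  proof (cases "as = []")
    case True
    then show ?thesis using C by auto
  next
    case False
    then have "a * r' \<ge> 1"
      using a IH mult_mono[of 1 a 1 r'] by auto
    then show ?thesis using IH by linarith
  qed
  ultimately show ?case using IH by (auto simp: eqs)
qed auto

section \<open>Denominators of finite continued fractions as continuants\<close>

lemma cfrac_fin_eq_cmat:
  assumes "\<forall>a\<in>set as. a \<ge> 1" "as \<noteq> []" "cmat as = (p, r, s, t)"
  shows "cfrac_fin as = of_int p / of_int s"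
  using assms
proof (induction as arbitrary: p r s t rule: cfrac_fin.induct)
  case (2 a b as)
  obtain p' r' s' t' where C: "cmat (b # as) = (p', r', s', t')"
    by (cases "cmat (b # as)")
  have "cfrac_fin (b # as) = of_int p' / of_int s'"
    using 2 C by simp
  moreover have "p' \<ge> 1" "s' \<ge> 1"
    using cmat_positive[OF _ C] 2 by auto
  moreover have "p = a * p' + s'" "s = p'"
    using 2(4) unfolding cmat.simps(2)[of a] C by auto
  ultimately show ?case
    unfolding cfrac_fin.simps by (simp add: add_divide_distrib)
qed auto

text \<open>The lower row of \<open>cmat as\<close> is the upper row of \<open>cmat (tl as)\<close>.
  Determinant plus or minus one makes the matrix fraction reduced, and a reduced fraction with
  positive denominator is unique.\<close>

lemma continuant_tl_eq_denominator:
  assumes "\<forall>a\<in>set as. 1 \<le> a" "as \<noteq> []" "coprime p q" "q \<ge> 1"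
    and "of_int p / of_int q = cfrac_fin as"
  shows "continuant (tl as) = q"
proof -
  obtain P R S T where C: "cmat as = (P, R, S, T)"
    by (cases "cmat as")
  have pos: "P \<ge> 1" "S \<ge> 1"
    using cmat_positive[OF assms(1) C] assms(2) by auto
  have "P * T - R * S = (-1) ^ length as"
    using mdet_cmat[of as] C by simp
  then have "\<bar>P * T - R * S\<bar> = 1" by (simp add: power_abs)
  then have co: "coprime P S"
    by (intro coprimeI)
      (metis dvd_abs_iff dvd_diff dvd_mult dvd_mult2)
  have "real_of_int p / of_int q = of_int P / of_int S"
    using cfrac_fin_eq_cmat[OF assms(1,2) C] assms(5) by simp
  then have "real_of_int (p * S) = of_int (P * q)"
    using pos assms(4) by (simp add: field_simps)
  then have eq: "p * S = P * q" by (simp only: of_int_eq_iff)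
  then have "S dvd q" "q dvd S"
    using co assms(3) by (metis coprime_commute coprime_dvd_mult_right_iff dvd_triv_right)+
  then have "S = q" using pos assms(4) by (simp add: zdvd_antisym_nonneg)
  moreover have "continuant (tl as) = S"
    using C assms(2) by (cases as; cases "cmat (tl as)") (auto simp: continuant_def)
  ultimately show ?thesis by simp
qed

section \<open>Words with end quotients at least two, and the symmetric period\<close>

text \<open>A leading one is absorbed into its neighbour, which costs one in the bound. The clause
  on \<open>last\<close> ensures that treating one end does not spoil the other.\<close>

lemma continuant_head_ge_2:
  assumes "\<forall>a\<in>set as. 1 \<le> a \<and> a \<le> m" "continuant as > 1"
  shows "\<exists>bs. bs \<noteq> [] \<and> (\<forall>b\<in>set bs. 1 \<le> b \<and> b \<le> m + 1) \<and> continuant bs = continuant as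
           \<and> hd bs \<ge> 2 \<and> (last as \<ge> 2 \<longrightarrow> last bs \<ge> 2)"
proof (cases "hd as \<ge> 2")
  case True
  moreover have "as \<noteq> []" using assms(2) by (auto simp: continuant_def)
  ultimately show ?thesis using assms by (intro exI[of _ as]) force
next
  case False
  obtain a cs where as: "as = a # cs"
    using assms(2) by (cases as) (auto simp: continuant_def)
  with False assms(1) have a: "a = 1" by auto
  \<comment> \<open>The word \<open>[1]\<close> has continuant one, so a second quotient
    exists.\<close>
  obtain b ds where cs: "cs = b # ds"
    using assms(2) by (cases cs) (auto simp: continuant_def as a)
  show ?thesis
    using assms(1)
    by (intro exI[of _ "(b + 1) # ds"]) (auto simp: as a cs continuant_merge_one)
qed

text \<open>Absorb a one at the head, reverse, and do the same at the other end; the bound grows by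
  at most one each time.\<close>

lemma continuant_ends_ge_2:
  assumes "\<forall>a\<in>set as. 1 \<le> a \<and> a \<le> m" "continuant as > m + 2" "m \<ge> 0"
  shows "\<exists>a ms b. a \<ge> 2 \<and> b \<ge> 2 \<and> (\<forall>c\<in>set (a # ms @ [b]). 1 \<le> c \<and> c \<le> m + 2)
           \<and> continuant (a # ms @ [b]) = continuant as"
proof -
  obtain bs where bs: "bs \<noteq> []" "\<forall>b\<in>set bs. 1 \<le> b \<and> b \<le> m + 1"
      "continuant bs = continuant as" "hd bs \<ge> 2"
    using continuant_head_ge_2[OF assms(1)] assms(2,3) by auto
  obtain cs where cs: "cs \<noteq> []" "\<forall>c\<in>set cs. 1 \<le> c \<and> c \<le> m + 2"
      "continuant cs = continuant as" "hd cs \<ge> 2" "last cs \<ge> 2"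
    using continuant_head_ge_2[of "rev bs" "m + 1"] bs assms(2,3)
    by (auto simp: continuant_rev last_rev add.commute)
  obtain a ds where a: "cs = a # ds" using cs(1) by (cases cs) auto
  \<comment> \<open>A one-letter word has its letter as continuant, at most \<open>m + 2\<close>;
    the lower bound on the continuant excludes this.\<close>
  have "ds \<noteq> []"
    using cs assms(2) by (auto simp: a continuant_def)
  then obtain ms b where "ds = ms @ [b]" by (metis rev_exhaust)
  with a have "cs = a # ms @ [b]" by simp
  with cs show ?thesis by (intro exI[of _ a] exI[of _ ms] exI[of _ b]) simp
qed

text \<open>With \<open>S = (2, -1, 1, 0)\<close> and \<open>B\<close> the matrix of \<open>a # ms @ [b]\<close>, the list below has matrix
  \<open>S B S B\<^sup>T\<close> if \<open>det B = 1\<close> and \<open>S B S\<^sup>T B\<^sup>T\<close> if \<open>det B = -1\<close>. Indeed \<open>S\<close> is the matrix of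
  \<open>[1, 1]\<close> times \<open>(1, -1, 0, 1)\<close>, and multiplication by the latter from the left lowers the
  first partial quotient by one.\<close>

lemma symmetric_word:
  assumes "a \<ge> 2" "b \<ge> 2" "\<forall>c\<in>set (a # ms @ [b]). 1 \<le> c \<and> c \<le> m"
    and q: "q = continuant (a # ms @ [b])"
  shows "\<exists>w A B D. w \<noteq> [] \<and> (\<forall>c\<in>set w. 1 \<le> c \<and> c \<le> m) \<and> cmat w = (A, B, 2 * q\<^sup>2, D)
           \<and> A + D = 4 * q\<^sup>2 - 2 \<and> A * D - B * (2 * q\<^sup>2) = 1"
proof -
  obtain p r s t where C: "cmat ms = (p, r, s, t)"
    by (cases "cmat ms")
  have CT: "cmat (rev ms) = (p, s, r, t)"
    by (simp add: cmat_rev C)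
  have det: "p * t - r * s = (-1) ^ length ms"
    using mdet_cmat[of ms] by (simp add: C)
  have q: "q = (a * p + s) * b + (a * r + t)"
    using q by (simp add: continuant_def cmat_append C algebra_simps)
  define w where "w = (if even (length ms)
    then [1, 1, a - 1] @ ms @ [b, 1, 1, b - 1] @ rev ms @ [a]
    else [1, 1, a - 1] @ ms @ [b - 1, 1, 1, b] @ rev ms @ [a])"
  have w: "w \<noteq> []" "\<forall>c\<in>set w. 1 \<le> c \<and> c \<le> m"
    using assms(1-3) by (auto simp: w_def)
  obtain A B E D where W: "cmat w = (A, B, E, D)"
    by (cases "cmat w")
  have "even (length w)" by (simp add: w_def)
  then have dw: "A * D - B * E = 1"
    using mdet_cmat[of w] W by simp
  \<comment> \<open>The trace depends on the determinant of \<open>cmat ms\<close>, with opposite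
    signs for the two words; choosing the word by parity yields \<open>- 2\<close> in both
    cases.\<close>
  have "E = 2 * q\<^sup>2 \<and> A + D = 4 * q\<^sup>2 - 2"
  proof (cases "even (length ms)")
    case True
    then have "p * t - r * s = 1" using det by simp
    moreover have "E = 2 * q\<^sup>2" "A + D = 4 * q\<^sup>2 - 2 * (p * t - r * s)"
      using W True by (auto simp: w_def cmat_append C CT q power2_eq_square algebra_simps)
    ultimately show ?thesis by simp
  next
    case False
    then have "p * t - r * s = -1" using det by simp
    moreover have "E = 2 * q\<^sup>2" "A + D = 4 * q\<^sup>2 + 2 * (p * t - r * s)"
      using W False by (auto simp: w_def cmat_append C CT q power2_eq_square algebra_simps)
    ultimately show ?thesis by simp
  qed
  with w W dw show ?thesis by auto
qed

section \<open>Convergence of periodic continued fractions\<close>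

lemma cfrac_fin_ge_1:
  assumes "\<forall>a\<in>set as. a \<ge> 1" "as \<noteq> []"
  shows "cfrac_fin as \<ge> 1"
  using assms
  by (induction as rule: cfrac_fin.induct) (auto intro: add_increasing2)

text \<open>\<open>X\<close> lists the complete quotients. A single map
  \<open>x \<mapsto> a + 1 / x\<close> need not contract uniformly near \<open>1\<close>, but two of
  them together shrink distances on \<open>x \<ge> 1\<close> by a factor of at least four, hence the
  induction in steps of two.\<close>

lemma cfrac_fin_error:
  fixes X :: "nat \<Rightarrow> real"
  assumes "\<And>n. a n \<ge> 1" "\<And>n. X n \<ge> 1" "\<And>n. X n = of_int (a n) + 1 / X (Suc n)"
  shows "\<bar>cfrac_fin (map a [0..<Suc n]) - X 0\<bar> \<le> (1 / 4) ^ (n div 2)"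
  using assms
proof (induction n arbitrary: a X rule: induct_nat_012)
  case 0
  show ?case using 0(3)[of 0] 0(2)[of 1] by simp
next
  case 1
  have "1 / of_int (a 1) \<le> (1::real)" "0 < 1 / real_of_int (a 1)"
    using 1(1)[of 1] by simp_all
  moreover have "1 / X 1 \<le> 1" "0 < 1 / X 1"
    using 1(2)[of 1] by simp_all
  ultimately have "\<bar>1 / of_int (a 1) - 1 / X 1\<bar> \<le> 1" by linarith
  then show ?case using 1(3)[of 0] by simp
next
  case (ge2 n)
  define z where "z = cfrac_fin (map (\<lambda>k. a (k + 2)) [0..<Suc n])"
  have split: "map a [0..<Suc (Suc (Suc n))] = a 0 # a 1 # map (\<lambda>k. a (k + 2)) [0..<Suc n]"
  proof -
    have "[0..<Suc (Suc (Suc n))] = 0 # 1 # map (\<lambda>k. k + 2) [0..<Suc n]"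
      unfolding map_add_upt by (simp add: upt_conv_Cons numeral_2_eq_2 del: upt_Suc)
    then show ?thesis by simp
  qed
  have z: "cfrac_fin (map a [0..<Suc (Suc (Suc n))]) = a 0 + 1 / (a 1 + 1 / z)"
    unfolding split z_def by (simp add: upt_conv_Cons del: upt_Suc)
  have z1: "z \<ge> 1"
    unfolding z_def using ge2(3) by (intro cfrac_fin_ge_1) auto
  have step: "X (k + 2) = of_int (a (k + 2)) + 1 / X (Suc k + 2)" for k
    using ge2(5)[of "k + 2"] by simp
  have "\<bar>z - X (0 + 2)\<bar> \<le> (1 / 4) ^ (n div 2)"
    unfolding z_def
    by (rule ge2(1)[of "\<lambda>k. a (k + 2)" "\<lambda>k. X (k + 2)", OF ge2(3,4) step])
  then have IH: "\<bar>z - X 2\<bar> \<le> (1 / 4) ^ (n div 2)"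
    by (simp only: add_0)
  define b where "b = real_of_int (a 1)"
  have b: "b \<ge> 1" using ge2(3)[of 1] by (simp add: b_def)
  have x: "X 2 \<ge> 1" using ge2(4) .
  have X0: "X 0 = a 0 + 1 / (b + 1 / X 2)"
    using ge2(5)[of 0] ge2(5)[of 1] by (simp add: b_def numeral_2_eq_2)
  have ge2': "b * u + 1 \<ge> 2" if "u \<ge> 1" for u :: real
    using mult_mono[of 1 b 1 u] b that by simp
  have bpos: "b + 1 / u > 0" if "u \<ge> 1" for u :: real
    using b that by (simp add: add_pos_pos)
  \<comment> \<open>Both factors of the denominator are at least two, which gives the factor
    \<open>1 / 4\<close>.\<close>
  have "1 / (b + 1 / z) - 1 / (b + 1 / X 2) = (z - X 2) / ((b * z + 1) * (b * X 2 + 1))"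
    using ge2'[OF z1] ge2'[OF x] z1 x bpos[OF z1] bpos[OF x]
    by (simp add: divide_simps) (simp add: algebra_simps)
  then have "\<bar>cfrac_fin (map a [0..<Suc (Suc (Suc n))]) - X 0\<bar>
      = \<bar>z - X 2\<bar> / ((b * z + 1) * (b * X 2 + 1))"
    using z X0 ge2'[OF z1] ge2'[OF x] by (simp add: b_def abs_mult)
  also have "\<dots> \<le> \<bar>z - X 2\<bar> / (2 * 2)"
    using ge2'[OF z1] ge2'[OF x] by (intro divide_left_mono mult_mono) auto
  also have "\<dots> \<le> (1 / 4) ^ (Suc (Suc n) div 2)"
    using IH by simp
  finally show ?case .
qed

lemma has_cfracI:
  fixes X :: "nat \<Rightarrow> real"
  assumes "\<And>n. a n \<ge> 1" "\<And>n. X n \<ge> 1" "\<And>n. X n = of_int (a n) + 1 / X (Suc n)"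
  shows "has_cfrac (X 0) a"
proof -
  have "(\<lambda>n. (1 / 4 :: real) ^ n) \<longlonglongrightarrow> 0"
    by (simp add: LIMSEQ_power_zero)
  moreover have "filterlim (\<lambda>n::nat. n div 2) at_top at_top"
    by (rule filterlim_at_top_div_const_nat) simp
  ultimately have "(\<lambda>n. (1 / 4 :: real) ^ (n div 2)) \<longlonglongrightarrow> 0"
    by (rule filterlim_compose)
  then have "(\<lambda>n. cfrac_fin (map a [0..<Suc n]) - X 0) \<longlonglongrightarrow> 0"
    by (rule Lim_null_comparison[rotated])
      (intro always_eventually allI, unfold real_norm_def, rule cfrac_fin_error[of a X, OF assms])
  then show ?thesis
    unfolding has_cfrac_def by (rule LIM_zero_cancel)
qed

section \<open>Periodic expansions from fixed points\<close>

text \<open>The continued fraction with real last quotient \<open>x\<close>; for positive quotients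
  and \<open>x > 0\<close> it is the Moebius action of \<open>cmat as\<close> on
  \<open>x\<close>.\<close>

primrec cfrac_tail :: "int list \<Rightarrow> real \<Rightarrow> real" where
  "cfrac_tail [] x = x"
| "cfrac_tail (a # as) x = of_int a + 1 / cfrac_tail as x"

lemma cfrac_tail_pos:
  assumes "\<forall>a\<in>set as. a \<ge> 1" "x > 0"
  shows "cfrac_tail as x > 0 \<and> (as \<noteq> [] \<longrightarrow> cfrac_tail as x \<ge> 1)"
  using assms by (induction as) (auto intro: add_pos_pos add_increasing2)

lemma cfrac_tail_eq_cmat:
  assumes "\<forall>a\<in>set as. a \<ge> 1" "x > 0" "cmat as = (p, r, s, t)"
  shows "cfrac_tail as x = (p * x + r) / (s * x + t)"
  using assms
proof (induction as arbitrary: p r s t)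
  case (Cons a as)
  obtain p' r' s' t' where C: "cmat as = (p', r', s', t')"
    by (cases "cmat as")
  have IH: "cfrac_tail as x = (p' * x + r') / (s' * x + t')"
    using Cons C by auto
  have "p' * x + r' > 0"
    using cmat_positive[OF _ C] Cons.prems by (auto intro: add_pos_nonneg)
  moreover have "s' * x + t' > 0"
    using cfrac_tail_pos[of as x] Cons.prems IH \<open>p' * x + r' > 0\<close>
    by (simp add: zero_less_divide_iff)
  moreover have "p = a * p' + s'" "r = a * r' + t'" "s = p'" "t = r'"
    using Cons.prems C by auto
  ultimately show ?case
    unfolding cfrac_tail.simps IH by (simp add: field_simps)
qed auto

text \<open>The complete quotients of a fixed point are the suffixes of the period evaluated at
  \<open>x\<close>, so they repeat with the period and are at least one.\<close>

lemma periodic_cfrac_boundedI: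
  assumes "w \<noteq> []" "\<forall>c\<in>set w. 1 \<le> c \<and> c \<le> m" "x > 0" "cfrac_tail w x = x"
  shows "periodic_cfrac_bounded m x"
proof -
  define L where "L = length w"
  have L: "L > 0" using assms(1) by (simp add: L_def)
  define a where "a = (\<lambda>n. w ! (n mod L))"
  define X where "X = (\<lambda>n. cfrac_tail (drop (n mod L) w) x)"
  have a1: "a n \<ge> 1" for n
    using assms(2) L by (simp add: a_def L_def)
  have dr: "drop (n mod L) w = a n # drop (Suc (n mod L)) w" for n
    using L by (simp add: a_def L_def Cons_nth_drop_Suc)
  have X1: "X n \<ge> 1" for n
  proof -
    have "drop (n mod L) w \<noteq> []" using L by (simp add: L_def not_le)
    moreover have "\<forall>c\<in>set (drop (n mod L) w). c \<ge> 1"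
      using assms(2) by (auto dest: in_set_dropD)
    ultimately show ?thesis
      using cfrac_tail_pos assms(3) by (auto simp: X_def)
  qed
  have step: "X n = of_int (a n) + 1 / X (Suc n)" for n
  proof -
    have "X n = of_int (a n) + 1 / cfrac_tail (drop (Suc (n mod L)) w) x"
      by (simp add: X_def dr)
    \<comment> \<open>At the end of the period the empty suffix gives \<open>x\<close>, which the
      fixed point equation identifies with the value of the whole word.\<close>
    moreover have "cfrac_tail (drop (Suc (n mod L)) w) x = X (Suc n)"
    proof (cases "Suc (n mod L) = L")
      case True
      then show ?thesis
        using assms(4) by (simp add: X_def mod_Suc) (simp add: L_def)
    next
      case False
      then show ?thesis by (simp add: X_def mod_Suc)
    qed
    ultimately show ?thesis by simp
  qed
  have "has_cfrac (X 0) a"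
    using a1 X1 step by (rule has_cfracI)
  moreover have "X 0 = x" using assms(4) by (simp add: X_def)
  ultimately show ?thesis
    unfolding periodic_cfrac_bounded_def using assms(1,2)
    by (intro exI[of _ w]) (auto simp: a_def L_def)
qed

text \<open>The fixed point equation is quadratic with discriminant the squared trace minus four,
  that is \<open>16 * q\<^sup>2 * (q\<^sup>2 - 1)\<close>. By Pell this is \<open>\<delta>\<close>
  times the square of \<open>4 * q * y\<close>, and \<open>x\<close> is the larger root.\<close>

lemma periodic_cfrac_of_pell:
  fixes q y \<delta> :: int
  assumes "w \<noteq> []" "\<forall>c\<in>set w. 1 \<le> c \<and> c \<le> m" "cmat w = (A, B, 2 * q\<^sup>2, D)"
    and tr: "A + D = 4 * q\<^sup>2 - 2" and det: "A * D - B * (2 * q\<^sup>2) = 1"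
    and "q > 0" "y > 0" "\<delta> > 0" and pell: "q\<^sup>2 - \<delta> * y\<^sup>2 = 1"
    and x: "x = of_int (A - D) / of_int (4 * q\<^sup>2) + of_int y / of_int q * sqrt (of_int \<delta>)"
  shows "periodic_cfrac_bounded m x"
proof -
  have pos: "B \<ge> 1" "D \<ge> 0"
    using cmat_positive[OF _ assms(3)] assms(1,2) by auto
  define Q where "Q = real_of_int q"
  define v where "v = real_of_int y * sqrt (of_int \<delta>)"
  have Q: "Q > 0" and v: "v > 0" using assms(6-8) by (auto simp: Q_def v_def)
  have v2: "v * v = Q\<^sup>2 - 1"
  proof -
    have "v * v = of_int (\<delta> * y\<^sup>2)"
      using assms(8) by (simp add: v_def power2_eq_square)
    also have "\<delta> * y\<^sup>2 = q\<^sup>2 - 1" using pell by simp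
    finally show ?thesis by (simp add: Q_def)
  qed
  have tr': "real_of_int A + D = 4 * Q\<^sup>2 - 2"
    using arg_cong[OF tr, of real_of_int] by (simp add: Q_def)
  have det': "real_of_int A * D - B * (2 * Q\<^sup>2) = 1"
    using arg_cong[OF det, of real_of_int] by (simp add: Q_def)
  have xv: "4 * Q\<^sup>2 * x = A - D + 4 * Q * v"
    using Q by (simp add: x Q_def v_def field_simps power2_eq_square)
  have disc: "(4 * Q * v)\<^sup>2 = (A - D)\<^sup>2 + 8 * B * Q\<^sup>2"
  proof -
    have "(4 * Q * v)\<^sup>2 = (4 * Q\<^sup>2 - 2)\<^sup>2 - 4"
      using v2 by (simp add: power2_eq_square algebra_simps) algebra
    also have "\<dots> = (real_of_int A + D)\<^sup>2 - 4 * (real_of_int A * D - B * (2 * Q\<^sup>2))"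
      by (simp only: tr' det' mult_1_right)
    finally show ?thesis by (simp add: power2_eq_square algebra_simps)
  qed
  \<comment> \<open>Since \<open>B\<close> is positive, the root of the discriminant exceeds
    \<open>\<bar>A - D\<bar>\<close>, so the larger fixed point is positive.\<close>
  have "(real_of_int (D - A))\<^sup>2 < (4 * Q * v)\<^sup>2"
    using disc pos Q by (simp add: power2_commute)
  then have "real_of_int (D - A) < 4 * Q * v"
    using Q v by (meson less_eq_real_def mult_pos_pos power2_less_imp_less zero_less_numeral)
  then have "4 * Q\<^sup>2 * x > 0" using xv by simp
  then have x0: "x > 0" using Q by (simp add: zero_less_mult_iff)
  have "(4 * Q\<^sup>2 * x - (A - D))\<^sup>2 = (A - D)\<^sup>2 + 8 * B * Q\<^sup>2"
    using disc xv by simp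
  then have "(8 * Q\<^sup>2) * (2 * Q\<^sup>2 * x\<^sup>2 - (A - D) * x - B) = 0"
    by (simp add: power2_eq_square algebra_simps)
  then have "2 * Q\<^sup>2 * x\<^sup>2 - (A - D) * x - B = 0"
    using Q by (simp only: mult_eq_0_iff) simp
  then have fix': "2 * Q\<^sup>2 * x\<^sup>2 + D * x = A * x + B"
    by (simp add: algebra_simps)
  have "2 * Q\<^sup>2 * x + D > 0"
    using Q x0 pos by (simp add: add_pos_nonneg)
  then have "(A * x + B) / (2 * Q\<^sup>2 * x + D) = x"
    using fix' by (simp add: field_simps power2_eq_square)
  moreover have "cfrac_tail w x = (A * x + B) / (2 * Q\<^sup>2 * x + D)"
    using cfrac_tail_eq_cmat[OF _ x0 assms(3)] assms(2) by (simp add: Q_def)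
  ultimately show ?thesis
    using periodic_cfrac_boundedI[OF assms(1,2) x0] by simp
qed

section \<open>Infinitely many values in each field\<close>

lemma quadratic_coeff_unique:
  fixes r r' s s' d :: real
  assumes "r + s * d = r' + s' * d" "r \<in> \<rat>" "r' \<in> \<rat>" "s \<in> \<rat>" "s' \<in> \<rat>" "d \<notin> \<rat>"
  shows "s = s'"
proof (rule ccontr)
  assume "s \<noteq> s'"
  then have "d = (r' - r) / (s - s')"
    using assms(1) by (simp add: field_simps)
  then show False using assms by simp
qed

theorem mainTheorem3:
  assumes zaremba_conjecture
  shows "\<exists>m'::int. \<forall>\<delta>::int. \<delta> > 0 \<and> sqrt (of_int \<delta>) \<notin> \<rat> \<longrightarrow>
           infinite {x \<in> quadratic_field \<delta>. periodic_cfrac_bounded m' x}"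
proof -
  obtain m :: int where m: "\<And>q::int. q \<ge> 1 \<Longrightarrow>
      \<exists>p as. coprime p q \<and> as \<noteq> [] \<and> (\<forall>a\<in>set as. 1 \<le> a \<and> a \<le> m) \<and>
             of_int p / of_int q = cfrac_fin as"
    using assms unfolding zaremba_conjecture_def by blast
  obtain as :: "int list" where "as \<noteq> []" "\<forall>a\<in>set as. 1 \<le> a \<and> a \<le> m"
    using m[of 1] by auto
  then have m0: "m \<ge> 0" by (cases as) auto
  have "infinite {x \<in> quadratic_field \<delta>. periodic_cfrac_bounded (m + 2) x}"
    if \<delta>: "\<delta> > 0" "sqrt (of_int \<delta>) \<notin> \<rat>" for \<delta> :: int
  proof
    define S where "S = {x \<in> quadratic_field \<delta>. periodic_cfrac_bounded (m + 2) x}"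
    \<comment> \<open>The bound \<open>q > m + 2\<close> is what \<open>continuant_ends_ge_2\<close>
      requires; it also keeps \<open>q\<close> positive.\<close>
    define T where "T = {q::int. q > m + 2 \<and> (\<exists>y. y > 0 \<and> q\<^sup>2 - \<delta> * y\<^sup>2 = 1)}"
    assume "finite {x \<in> quadratic_field \<delta>. periodic_cfrac_bounded (m + 2) x}"
    then have "finite S" by (simp add: S_def)
    have "\<exists>x\<in>S. \<exists>r y. r \<in> \<rat> \<and> y > 0 \<and> q\<^sup>2 - \<delta> * y\<^sup>2 = 1 \<and>
            x = r + of_int y / of_int q * sqrt (of_int \<delta>)" if "q \<in> T" for q
    proof -
      from that obtain y where y: "q > m + 2" "y > 0" "q\<^sup>2 - \<delta> * y\<^sup>2 = 1"
        by (auto simp: T_def)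
      have "q \<ge> 1" using y m0 by simp
      from m[OF this] obtain p as where as: "coprime p q" "as \<noteq> []"
        "\<forall>a\<in>set as. 1 \<le> a \<and> a \<le> m" "of_int p / of_int q = cfrac_fin as" by blast
      have K: "continuant (tl as) = q"
        using as \<open>q \<ge> 1\<close> by (intro continuant_tl_eq_denominator) auto
      have "\<forall>a\<in>set (tl as). 1 \<le> a \<and> a \<le> m"
        using as(2,3) by (auto dest: list.set_sel(2))
      then obtain a ms b where "a \<ge> 2" "b \<ge> 2"
        "\<forall>c\<in>set (a # ms @ [b]). 1 \<le> c \<and> c \<le> m + 2" "q = continuant (a # ms @ [b])"
        using continuant_ends_ge_2[of "tl as" m] y(1) K m0 by metis
      from symmetric_word[OF this] obtain w A B D where w: "w \<noteq> []"
        "\<forall>c\<in>set w. 1 \<le> c \<and> c \<le> m + 2" "cmat w = (A, B, 2 * q\<^sup>2, D)"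
        "A + D = 4 * q\<^sup>2 - 2" "A * D - B * (2 * q\<^sup>2) = 1" by blast
      define r where "r = real_of_int (A - D) / of_int (4 * q\<^sup>2)"
      define x where "x = r + of_int y / of_int q * sqrt (of_int \<delta>)"
      have "periodic_cfrac_bounded (m + 2) x"
        using periodic_cfrac_of_pell[OF w _ y(2) \<delta>(1) y(3)] \<open>q \<ge> 1\<close>
        by (simp add: x_def r_def)
      moreover have r: "r \<in> \<rat>" by (simp add: r_def)
      moreover have "x \<in> quadratic_field \<delta>"
      proof -
        obtain u where "r = of_rat u"
          using r by (rule Rats_cases)
        moreover have "real_of_int y / of_int q \<in> \<rat>" by simp
        then obtain v where "real_of_int y / of_int q = of_rat v"
          by (rule Rats_cases)
        ultimately show ?thesis
          unfolding quadratic_field_def x_def by auto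
      qed
      ultimately have "x \<in> S" by (simp add: S_def)
      then show ?thesis using r y x_def by blast
    qed
    then obtain x where x: "\<And>q. q \<in> T \<Longrightarrow> x q \<in> S"
      "\<And>q. q \<in> T \<Longrightarrow> \<exists>r y. r \<in> \<rat> \<and> y > 0 \<and> q\<^sup>2 - \<delta> * y\<^sup>2 = 1 \<and>
            x q = r + of_int y / of_int q * sqrt (of_int \<delta>)" by metis
    have "inj_on x T"
    proof (rule inj_onI)
      fix q q' assume q: "q \<in> T" "q' \<in> T" "x q = x q'"
      obtain r y where y: "r \<in> \<rat>" "q\<^sup>2 - \<delta> * y\<^sup>2 = 1"
        "x q = r + of_int y / of_int q * sqrt (of_int \<delta>)" using x(2)[OF q(1)] by blast
      obtain r' y' where y': "r' \<in> \<rat>" "q'\<^sup>2 - \<delta> * y'\<^sup>2 = 1"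
        "x q' = r' + of_int y' / of_int q' * sqrt (of_int \<delta>)" using x(2)[OF q(2)] by blast
      have pos: "q > 0" "q' > 0" using q m0 by (auto simp: T_def)
      have "r + of_int y / of_int q * sqrt (of_int \<delta>) = r' + of_int y' / of_int q' * sqrt (of_int \<delta>)"
        using y(3) y'(3) q(3) by (simp only:)
      then have "real_of_int y / of_int q = of_int y' / of_int q'"
        by (rule quadratic_coeff_unique) (use y(1) y'(1) \<delta>(2) in simp_all)
      then have "real_of_int (y * q') = of_int (y' * q)"
        using pos by (simp add: field_simps)
      then have yq: "y * q' = y' * q" by (simp only: of_int_eq_iff)
      \<comment> \<open>Pell's equation reads
        \<open>1 / q\<^sup>2 = 1 - \<delta> * (y / q)\<^sup>2\<close>, so equal ratios force equal
        \<open>q\<close>; this is the same with denominators cleared.\<close>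
      have "q'\<^sup>2 * (q\<^sup>2 - \<delta> * y\<^sup>2) = q\<^sup>2 * q'\<^sup>2 - \<delta> * (y * q')\<^sup>2" by algebra
      also have "\<dots> = q\<^sup>2 * (q'\<^sup>2 - \<delta> * y'\<^sup>2)" unfolding yq by algebra
      finally have "q'\<^sup>2 = q\<^sup>2" using y y' by simp
      then show "q = q'" using pos by (simp add: power2_eq_iff)
    qed
    moreover have "x ` T \<subseteq> S" using x(1) by blast
    ultimately have "finite T"
      using \<open>finite S\<close> by (rule inj_on_finite)
    \<comment> \<open>Truncation by \<open>nat\<close> can only raise the bound. Should
      \<open>T\<close> be empty, \<open>Max T\<close> is some unspecified integer, and exceeding it
      is harmless.\<close>
    obtain q y where q: "q > int (nat (max (Max T) (m + 2)))" "y > 0" "q\<^sup>2 - \<delta> * y\<^sup>2 = 1"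
      using pell_unbounded[OF \<delta>] by blast
    from q(1) have "q > m + 2" "q > Max T" by linarith+
    with q(2,3) have "q \<in> T" by (auto simp: T_def)
    with \<open>finite T\<close> have "q \<le> Max T" by (rule Max_ge)
    with \<open>q > Max T\<close> show False by simp
  qed
  then show ?thesis by blast
qed

end
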